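(* Let $A$ be a finite alphabet. For every sentence $I$ over $A$, the coproduct of the fundamental coloured quasi-symmetric function $F_I$ in $\mathrm{QSym}_A$ is $$\delta(F_I)=\sum_{(K',K'')}F_{K'}\otimes F_{K''},$$ where the summation is over all pairs of sentences $(K',K'')$ which give $I$ by concatenation or by near-concatenation, i.e. such that $K'\cdot K''=I$ or $K'\odot K''=I$.
   Context: $\Bbbk$ is a field of characteristic zero. A sentence $I=(w_1,\dots,w_m)$ over $A$ is a finite sequence of non-empty words in letters of $A$; $1$ is the empty sentence. The concatenation of $I=(w_1,\dots,w_m)$ and $J=(v_1,\dots,v_n)$ is $I\cdot J=(w_1,\dots,w_m,v_1,\dots,v_n)$; for non-empty sentences $I,J$ the near-concatenation is $I\odot J=(w_1,\dots,w_{m-1},w_mv_1,v_2,\dots,v_n)$. Write $J\preccurlyeq I$ ($J$ refines $I$) if the words of $I$ can be obtained by concatenating adjacent words of $J$. $\mathrm{QSym}_A$ is the Hopf algebra over $\Bbbk$ with linear basis $(M_I)$ indexed by sentences over $A$ and coproduct $\delta(M_I)=\sum_{J\cdot K=I}M_J\otimes M_K$ (it is the graded dual of the Hopf algebra $\mathrm{NSym}_A$ with basis $(H_I)$ dual to $(M_I)$). The fundamental coloured quasi-symmetric functions are $F_I=\sum_{J\preccurlyeq I}M_J$. *)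

theory Defs
  imports Complex_Main "HOL-Library.Poly_Mapping"
begin

type_synonym 'a word = "'a list"
type_synonym 'a sentence = "'a word list"

definition sentences :: "'a set \<Rightarrow> 'a sentence set" where
  "sentences A = lists (lists A - {[]})"

text \<open>Concatenation of sentences is list append. Near-concatenation fuses the last word of
  the first sentence with the first word of the second one; it is meaningful only for
  non-empty sentences.\<close>

definition near_concat :: "'a sentence \<Rightarrow> 'a sentence \<Rightarrow> 'a sentence" where
  "near_concat I J = butlast I @ [last I @ hd J] @ tl J"

text \<open>\<open>J\<close> refines \<open>I\<close>: \<open>J\<close> can be cut into non-empty blocks of adjacent words such that
  the words of \<open>I\<close> are the concatenations of the words in the successive blocks.\<close>

definition refines :: "'a sentence \<Rightarrow> 'a sentence \<Rightarrow> bool" (infix "\<preceq>\<^sub>r" 50) where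
  "J \<preceq>\<^sub>r I \<longleftrightarrow> (\<exists>Bs. [] \<notin> set Bs \<and> concat Bs = J \<and> map concat Bs = I)"

text \<open>All index sets of the sums below are finite, even for infinite alphabets.\<close>

lemma finite_sentences_bounded:
  "finite {J \<in> sentences A. set (concat J) \<subseteq> set u \<and> length (concat J) \<le> length u}"
    (is "finite ?S")
proof -
  let ?W = "{w. set w \<subseteq> set u \<and> length w \<le> length u}"
  have len: "length J \<le> length (concat J)" if "[] \<notin> set J" for J :: "'a sentence"
    using that by (induction J) (auto simp: Suc_le_eq intro: add_strict_increasing)
  have lenw: "length w \<le> length (concat J)" if "w \<in> set J" for w and J :: "'a sentence"
    using that by (induction J) auto
  have "?S \<subseteq> {J. set J \<subseteq> ?W \<and> length J \<le> length u}"
    using len lenw by (fastforce simp: sentences_def intro: le_trans)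
  moreover have "finite ?W" by (rule finite_lists_length_le) simp
  ultimately show ?thesis
    using finite_lists_length_le[of ?W "length u"] finite_subset by blast
qed

lemma finite_refinements: "finite {J \<in> sentences A. J \<preceq>\<^sub>r I}"
proof -
  have "concat J = concat I" if "J \<preceq>\<^sub>r I" for J
  proof -
    from that obtain Bs where "concat Bs = J" "map concat Bs = I"
      by (auto simp: refines_def)
    moreover have "concat (map concat Bs) = concat (concat Bs)" by (induction Bs) auto
    ultimately show ?thesis by simp
  qed
  then show ?thesis
    by (intro finite_subset[OF _ finite_sentences_bounded[of A "concat I"]]) (auto simp del: set_concat)
qed

lemma concat_near_concat:
  assumes "I \<noteq> []" "J \<noteq> []"
  shows "concat (near_concat I J) = concat I @ concat J"
proof -
  have "concat J = hd J @ concat (tl J)"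
    using assms by (cases J) auto
  moreover have "concat I = concat (butlast I) @ last I"
    using assms by (cases I rule: rev_cases) auto
  ultimately show ?thesis by (simp add: near_concat_def)
qed

lemma finite_decompositions:
  "finite {(K', K'') \<in> sentences A \<times> sentences A.
     K' @ K'' = I \<or> (K' \<noteq> [] \<and> K'' \<noteq> [] \<and> near_concat K' K'' = I)}" (is "finite ?P")
proof -
  let ?S = "{J \<in> sentences A. set (concat J) \<subseteq> set (concat I) \<and> length (concat J) \<le> length (concat I)}"
  have "?P \<subseteq> ?S \<times> ?S"
  proof (rule subrelI)
    fix K' K''
    assume "(K', K'') \<in> ?P"
    then have K: "K' \<in> sentences A" "K'' \<in> sentences A"
      and "K' @ K'' = I \<or> (K' \<noteq> [] \<and> K'' \<noteq> [] \<and> near_concat K' K'' = I)"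
      by auto
    from this(3) have "concat I = concat K' @ concat K''"
      using concat_near_concat[of K' K''] by auto
    then show "(K', K'') \<in> ?S \<times> ?S" using K by (simp del: set_concat)
  qed
  then show ?thesis
    by (rule finite_subset) (intro finite_cartesian_product finite_sentences_bounded)
qed

text \<open>The vector space with linear basis indexed by a set \<open>S\<close> is modelled by the finitely
  supported functions on \<open>S\<close>; the basis vector with index \<open>i\<close> is \<^term>\<open>Poly_Mapping.single i 1\<close>.
  The tensor product of two such spaces has as linear basis the tensors of basis vectors and is
  modelled by the finitely supported functions on pairs of indices.\<close>

abbreviation "lookup \<equiv> Poly_Mapping.lookup"
abbreviation "keys \<equiv> Poly_Mapping.keys"

definition scale :: "'k::field \<Rightarrow> ('i \<Rightarrow>\<^sub>0 'k) \<Rightarrow> ('i \<Rightarrow>\<^sub>0 'k)" where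
  "scale c x = Poly_Mapping.map ((*) c) x"

lemma lookup_scale [simp]: "lookup (scale c x) i = c * lookup x i"
  by (auto simp: scale_def Poly_Mapping.map.rep_eq when_def)

interpretation free: vector_space scale
  by unfold_locales (auto intro!: poly_mapping_eqI simp: lookup_add algebra_simps)

definition tensor :: "('i \<Rightarrow>\<^sub>0 'k::field) \<Rightarrow> ('j \<Rightarrow>\<^sub>0 'k) \<Rightarrow> ('i \<times> 'j \<Rightarrow>\<^sub>0 'k)" (infixr "\<otimes>" 70) where
  "x \<otimes> y = (\<Sum>i\<in>keys x. \<Sum>j\<in>keys y. Poly_Mapping.single (i, j) (lookup x i * lookup y j))"

lemma lookup_tensor: "lookup (x \<otimes> y) (i, j) = lookup x i * lookup y j"
proof -
  have "lookup (x \<otimes> y) (i, j) = (\<Sum>i'\<in>keys x. \<Sum>j'\<in>keys y.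
      if i' = i then if j' = j then lookup x i * lookup y j else 0 else 0)"
    unfolding tensor_def lookup_sum
    by (intro sum.cong) (auto simp: lookup_single when_def)
  also have "\<dots> = (\<Sum>i'\<in>keys x.
      if i' = i then (\<Sum>j'\<in>keys y. if j' = j then lookup x i * lookup y j else 0) else 0)"
    by (intro sum.cong) auto
  also have "\<dots> = lookup x i * lookup y j"
    by (auto simp: sum.delta in_keys_iff)
  finally show ?thesis .
qed

lemma tensor_single:
  "Poly_Mapping.single i (1 :: 'k::field) \<otimes> Poly_Mapping.single j 1 = Poly_Mapping.single (i, j) 1"
  by (simp add: tensor_def)

definition lin_ext :: "('i \<Rightarrow> ('j \<Rightarrow>\<^sub>0 'k::field)) \<Rightarrow> ('i \<Rightarrow>\<^sub>0 'k) \<Rightarrow> ('j \<Rightarrow>\<^sub>0 'k)" where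
  "lin_ext f x = (\<Sum>i\<in>keys x. scale (lookup x i) (f i))"

lemma lin_ext_superset:
  assumes "finite S" "keys x \<subseteq> S"
  shows "lin_ext f x = (\<Sum>i\<in>S. scale (lookup x i) (f i))"
  unfolding lin_ext_def using assms
  by (intro sum.mono_neutral_left) (auto simp: in_keys_iff)

lemma lin_ext_single [simp]: "lin_ext f (Poly_Mapping.single i 1) = f i"
  by (simp add: lin_ext_def)

lemma linear_lin_ext:
  fixes f :: "'i \<Rightarrow> ('j \<Rightarrow>\<^sub>0 'k::field)"
  shows "Vector_Spaces.linear scale scale (lin_ext f)"
proof (rule Vector_Spaces.linear_iff[THEN iffD2], intro conjI allI)
  fix x y :: "'i \<Rightarrow>\<^sub>0 'k" and c :: 'k
  have k: "keys (x + y) \<subseteq> keys x \<union> keys y" by (rule Poly_Mapping.keys_add)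
  show "lin_ext f (x + y) = lin_ext f x + lin_ext f y"
    by (simp add: lin_ext_superset[of "keys x \<union> keys y"] k lookup_add
        free.scale_left_distrib sum.distrib)
  have "keys (scale c x) \<subseteq> keys x" by (auto simp: in_keys_iff)
  then show "lin_ext f (scale c x) = scale c (lin_ext f x)"
    by (simp add: lin_ext_superset[of "keys x"] free.scale_sum_right)
qed (rule free.vector_space_axioms)+

definition QSym :: "'a set \<Rightarrow> ('a sentence \<Rightarrow>\<^sub>0 'k::field_char_0) set" where
  "QSym A = {x. keys x \<subseteq> sentences A}"

definition M :: "'a sentence \<Rightarrow> ('a sentence \<Rightarrow>\<^sub>0 'k::field_char_0)" where
  "M I = Poly_Mapping.single I 1"

lemma QSym_basis:
  "free.independent (M ` sentences A :: ('a sentence \<Rightarrow>\<^sub>0 'k::field_char_0) set)"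
  "free.span (M ` sentences A) = (QSym A :: ('a sentence \<Rightarrow>\<^sub>0 'k::field_char_0) set)"
  "inj (M :: 'a sentence \<Rightarrow> ('a sentence \<Rightarrow>\<^sub>0 'k::field_char_0))"
proof -
  show inj: "inj (M :: 'a sentence \<Rightarrow> ('a sentence \<Rightarrow>\<^sub>0 'k))"
    by (rule injI) (metis M_def keys_single singleton_iff zero_neq_one)
  have *: "free.span (M ` S) \<subseteq> {x :: 'a sentence \<Rightarrow>\<^sub>0 'k. keys x \<subseteq> S}" for S
  proof (rule free.span_minimal)
    show "free.subspace {x :: 'a sentence \<Rightarrow>\<^sub>0 'k. keys x \<subseteq> S}"
    proof (rule free.subspaceI)
      fix x y :: "'a sentence \<Rightarrow>\<^sub>0 'k" assume "x \<in> {x. keys x \<subseteq> S}" "y \<in> {x. keys x \<subseteq> S}"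
      then show "x + y \<in> {x. keys x \<subseteq> S}" using Poly_Mapping.keys_add[of x y] by auto
    qed (auto simp: in_keys_iff subset_iff)
  qed (auto simp: M_def)
  show "free.independent (M ` sentences A :: ('a sentence \<Rightarrow>\<^sub>0 'k) set)"
    unfolding free.dependent_def
  proof clarify
    fix I assume "(M I :: 'a sentence \<Rightarrow>\<^sub>0 'k) \<in> free.span (M ` sentences A - {M I})"
    moreover have "M ` sentences A - {M I :: 'a sentence \<Rightarrow>\<^sub>0 'k} = M ` (sentences A - {I})"
      using inj by (auto simp: inj_def)
    ultimately show False using *[of "sentences A - {I}"] by (auto simp: M_def)
  qed
  show "free.span (M ` sentences A) = (QSym A :: ('a sentence \<Rightarrow>\<^sub>0 'k) set)"
  proof
    show "(QSym A :: ('a sentence \<Rightarrow>\<^sub>0 'k) set) \<subseteq> free.span (M ` sentences A)"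
    proof
      fix x :: "'a sentence \<Rightarrow>\<^sub>0 'k" assume x: "x \<in> QSym A"
      have "x = lin_ext M x"
        by (rule poly_mapping_eqI)
          (auto simp: lin_ext_def lookup_sum M_def lookup_single when_def in_keys_iff if_distrib cong: if_cong)
      also have "\<dots> \<in> free.span (M ` sentences A)"
        unfolding lin_ext_def using x
        by (intro free.span_sum free.span_scale free.span_base) (auto simp: QSym_def)
      finally show "x \<in> free.span (M ` sentences A)" .
    qed
  qed (use *[of "sentences A"] in \<open>simp add: QSym_def\<close>)
qed

definition coproduct ::
    "'a set \<Rightarrow> ('a sentence \<Rightarrow>\<^sub>0 'k::field_char_0) \<Rightarrow> ('a sentence \<times> 'a sentence \<Rightarrow>\<^sub>0 'k)" where
  "coproduct A = lin_ext (\<lambda>I.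
     \<Sum>(J, K) \<in> {(J, K) \<in> sentences A \<times> sentences A. J @ K = I}. M J \<otimes> M K)"

lemma coproduct_M:
  "coproduct A (M I :: 'a sentence \<Rightarrow>\<^sub>0 'k::field_char_0) =
    (\<Sum>(J, K) \<in> {(J, K) \<in> sentences A \<times> sentences A. J @ K = I}. M J \<otimes> M K)"
  unfolding coproduct_def by (subst (1) M_def) (rule lin_ext_single)

definition F :: "'a set \<Rightarrow> 'a sentence \<Rightarrow> ('a sentence \<Rightarrow>\<^sub>0 'k::field_char_0)" where
  "F A I = (\<Sum>J \<in> {J \<in> sentences A. J \<preceq>\<^sub>r I}. M J)"

lemma F_in_QSym: "F A I \<in> QSym A"
  unfolding F_def QSym_basis(2)[symmetric]
  by (intro free.span_sum free.span_base) auto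

end

(* Compare the coefficients of M_J tensor M_K on both sides. On the left it is 1 if J @ K refines I,
   and 0 otherwise. On the right it counts the decompositions (K', K'') of I such that J refines K'
   and K refines K''. If J @ K refines I, the cut between J and K falls either between two words
   of I (giving a concatenation) or inside a word of I (giving a near-concatenation); so there is
   such a decomposition. It is unique, because concat K' = concat J prescribes the position of
   the cut and I has no empty words. *)
theory Submission
  imports Defs
begin

text \<open>The index condition of the sum as a predicate on arbitrary lists of words: it obeys a
  recursion on \<open>I\<close> that runs parallel to the one for refinement.\<close>

definition decomposes :: "'a sentence \<Rightarrow> 'a sentence \<Rightarrow> 'a sentence \<Rightarrow> bool" where
  "decomposes I K' K'' \<longleftrightarrow>
    K' @ K'' = I \<or> (K' \<noteq> [] \<and> K'' \<noteq> [] \<and> near_concat K' K'' = I)"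

lemma decomposes_Nil_left [simp]: "decomposes I [] K'' \<longleftrightarrow> K'' = I"
  by (auto simp: decomposes_def)

lemma decomposes_Nil [simp]: "decomposes [] K' K'' \<longleftrightarrow> K' = [] \<and> K'' = []"
  by (auto simp: decomposes_def near_concat_def)

text \<open>Either \<open>v\<close> stays whole and the cut is sought further on, or
  near-concatenation splits \<open>v\<close> itself, so that \<open>K'\<close> ends with
  \<open>k\<close>. Empty words are still allowed here.\<close>

lemma decomposes_Cons_Cons:
  "decomposes (v # I) (k # K') K'' \<longleftrightarrow>
    (k = v \<and> decomposes I K' K'') \<or> (K' = [] \<and> (\<exists>w. K'' = w # I \<and> k @ w = v))"
  by (cases K'; cases K'') (auto simp: decomposes_def near_concat_def)

lemma refines_Nil [simp]: "J \<preceq>\<^sub>r [] \<longleftrightarrow> J = []"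
  by (auto simp: refines_def)

text \<open>Peels off the block \<open>B\<close> that is fused into \<open>v\<close>; the inductions
  about refinement use this form in place of the full list of blocks.\<close>

lemma refines_Cons:
  "J \<preceq>\<^sub>r v # I \<longleftrightarrow> (\<exists>B C. B \<noteq> [] \<and> concat B = v \<and> C \<preceq>\<^sub>r I \<and> J = B @ C)"
proof
  assume "J \<preceq>\<^sub>r v # I"
  then obtain Bs where Bs: "[] \<notin> set Bs \<and> concat Bs = J \<and> map concat Bs = v # I"
    unfolding refines_def ..
  then obtain B Bs' where "Bs = B # Bs'" by (cases Bs) simp_all
  with Bs have B: "B \<noteq> []" "concat B = v" "J = B @ concat Bs'"
    and Bs': "[] \<notin> set Bs' \<and> concat Bs' = concat Bs' \<and> map concat Bs' = I" by auto
  from Bs' have "concat Bs' \<preceq>\<^sub>r I" unfolding refines_def by (rule exI)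
  with B show "\<exists>B C. B \<noteq> [] \<and> concat B = v \<and> C \<preceq>\<^sub>r I \<and> J = B @ C" by blast
next
  assume "\<exists>B C. B \<noteq> [] \<and> concat B = v \<and> C \<preceq>\<^sub>r I \<and> J = B @ C"
  then obtain B C where B: "B \<noteq> []" "concat B = v" "J = B @ C" and "C \<preceq>\<^sub>r I" by blast
  from \<open>C \<preceq>\<^sub>r I\<close> obtain Bs where Bs: "[] \<notin> set Bs \<and> concat Bs = C \<and> map concat Bs = I"
    unfolding refines_def ..
  show "J \<preceq>\<^sub>r v # I"
    unfolding refines_def by (rule exI[of _ "B # Bs"]) (use B Bs in simp)
qed

lemma concat_refines:
  assumes "J \<preceq>\<^sub>r I"
  shows "concat J = concat I"
  using assms by (induction I arbitrary: J) (auto simp: refines_Cons)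

text \<open>Blocks of \<open>J\<close> and \<open>K\<close> remain blocks for \<open>I\<close>,
  except that near-concatenation merges the last block of \<open>J\<close> with the first one of
  \<open>K\<close>.\<close>

lemma refines_append_decomposes:
  assumes "decomposes I K' K''" "J \<preceq>\<^sub>r K'" "K \<preceq>\<^sub>r K''"
  shows "J @ K \<preceq>\<^sub>r I"
  using assms
proof (induction I arbitrary: J K')
  case (Cons v I)
  show ?case
  proof (cases K')
    case (Cons k L)
    with Cons.prems obtain B C where BC: "B \<noteq> []" "concat B = k" "C \<preceq>\<^sub>r L" "J = B @ C"
      by (auto simp: refines_Cons)
    consider "k = v" "decomposes I L K''" | w where "L = []" "K'' = w # I" "k @ w = v"
      using Cons Cons.prems(1) by (auto simp: decomposes_Cons_Cons)
    then show ?thesis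
    proof cases
      case 1
      with BC Cons.IH[of L C] Cons.prems(3) show ?thesis
        unfolding refines_Cons by (intro exI[of _ B] exI[of _ "C @ K"]) auto
    next
      case 2
      with Cons.prems(3) obtain D E where "concat D = w" "E \<preceq>\<^sub>r I" "K = D @ E"
        by (auto simp: refines_Cons)
      with 2 BC show ?thesis
        unfolding refines_Cons by (intro exI[of _ "B @ D"] exI[of _ E]) auto
    qed
  qed (use Cons.prems in simp)
qed simp

lemma decomposes_refines_append:
  assumes "J @ K \<preceq>\<^sub>r I"
  obtains K' K'' where "decomposes I K' K''" "J \<preceq>\<^sub>r K'" "K \<preceq>\<^sub>r K''"
proof -
  have "\<exists>K' K''. decomposes I K' K'' \<and> J \<preceq>\<^sub>r K' \<and> K \<preceq>\<^sub>r K''"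
    using assms
  proof (induction I arbitrary: J)
    case (Cons v I)
    then obtain B C where BC: "B \<noteq> []" "concat B = v" "C \<preceq>\<^sub>r I" "J @ K = B @ C"
      by (auto simp: refines_Cons)
    \<comment> \<open>\<open>D\<close> is the overlap: the part of \<open>J\<close> beyond the first
      block \<open>B\<close>, or the part of \<open>B\<close> beyond \<open>J\<close>.\<close>
    then obtain D where "J = B @ D \<and> C = D @ K \<or> B = J @ D \<and> K = D @ C"
      by (auto simp: append_eq_append_conv2)
    \<comment> \<open>The tie \<open>J = B\<close> is counted as a cut between words, so that
      \<open>D\<close> is a legitimate block in the second case.\<close>
    then consider "J = B @ D" "C = D @ K" | "D \<noteq> []" "B = J @ D" "K = D @ C"
      by (cases "D = []") auto
    then show ?case
    proof cases
      case 1
      with BC Cons.IH[of D] obtain K' K'' where "decomposes I K' K''" "D \<preceq>\<^sub>r K'" "K \<preceq>\<^sub>r K''"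
        by auto
      with 1 BC have "decomposes (v # I) (v # K') K''" "J \<preceq>\<^sub>r v # K'"
        by (auto simp: decomposes_Cons_Cons refines_Cons)
      with \<open>K \<preceq>\<^sub>r K''\<close> show ?thesis by blast
    next
      case 2
      show ?thesis
      \<comment> \<open>An empty \<open>J\<close> cannot serve as the block of a word; it refines
        only the empty sentence, so the cut is before \<open>v\<close>.\<close>
      proof (cases "J = []")
        case True
        with Cons.prems show ?thesis by (intro exI[of _ "[]"] exI[of _ "v # I"]) simp
      next
        case False
        with 2 BC show ?thesis
          by (intro exI[of _ "[concat J]"] exI[of _ "concat D # I"])
            (auto simp: decomposes_Cons_Cons refines_Cons)
      qed
    qed
  qed simp
  then show thesis using that by blast
qed

lemma refines_nonempty_words:
  assumes "J \<preceq>\<^sub>r I" "[] \<notin> set J"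
  shows "[] \<notin> set I"
  using assms
proof (induction I arbitrary: J)
  case (Cons v I)
  then obtain B C where BC: "B \<noteq> []" "concat B = v" "C \<preceq>\<^sub>r I" "J = B @ C"
    by (auto simp: refines_Cons)
  with Cons.prems(2) have "v \<noteq> []" by (cases B) auto
  with Cons.IH[of C] BC Cons.prems(2) show ?case by auto
qed simp

lemma sentences_iff: "I \<in> sentences A \<longleftrightarrow> set (concat I) \<subseteq> A \<and> [] \<notin> set I"
  by (auto simp: sentences_def)

lemma append_in_sentences: "I @ J \<in> sentences A \<longleftrightarrow> I \<in> sentences A \<and> J \<in> sentences A"
  by (auto simp: sentences_def)

text \<open>Places the \<open>K'\<close> and \<open>K''\<close> found from refinements inside the
  index set: refinement keeps the letters, and a non-empty block of non-empty words has a non-empty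
  concatenation.\<close>

lemma refines_in_sentences:
  assumes "J \<preceq>\<^sub>r I" "J \<in> sentences A"
  shows "I \<in> sentences A"
  using assms concat_refines[OF assms(1)] refines_nonempty_words[OF assms(1)]
  by (simp add: sentences_iff del: set_concat)

text \<open>Empty words must be excluded: \<open>([v], I)\<close> and \<open>([v], [] # I)\<close>
  both decompose \<open>v # I\<close>, with equal first concatenations.\<close>

lemma decomposes_unique:
  assumes "decomposes I K' K''" "decomposes I L' L''" "concat K' = concat L'"
    and "[] \<notin> set K'" "[] \<notin> set K''" "[] \<notin> set L'" "[] \<notin> set L''"
  shows "K' = L' \<and> K'' = L''"
  using assms
proof (induction I arbitrary: K' L')
  case (Cons v I)
  show ?case
  proof (cases "K' = [] \<or> L' = []")
    case True
    with Cons.prems have "K' = [] \<and> L' = []" by (cases K'; cases L') auto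
    with Cons.prems show ?thesis by simp
  next
    case False
    then obtain k K1 l L1 where KL: "K' = k # K1" "L' = l # L1"
      by (auto simp: neq_Nil_conv)
    \<comment> \<open>If only one pair splits \<open>v\<close>, say \<open>l @ w = v\<close>, then
      \<open>v @ concat K1 = l\<close> forces \<open>w = []\<close>, which is excluded. If both
      split \<open>v\<close>, then \<open>k = l\<close> and the remainders agree.\<close>
    with Cons.prems Cons.IH[of K1 L1] show ?thesis
      by (auto simp: decomposes_Cons_Cons)
  qed
qed simp

lemma lookup_M: "lookup (M I) J = (if J = I then 1 else 0)"
  by (simp add: M_def lookup_single when_def)

lemma lookup_F: "lookup (F A I) J = (if J \<in> sentences A \<and> J \<preceq>\<^sub>r I then 1 else 0)"
  unfolding F_def lookup_sum lookup_M
  using finite_refinements[of A I] by (simp add: sum.delta)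

text \<open>Deconcatenation is dual to concatenation: the pair \<open>(J, K)\<close> can occur only
  in the coproduct of \<open>M (J @ K)\<close>, and there at most once.\<close>

lemma lookup_coproduct:
  fixes x :: "'a sentence \<Rightarrow>\<^sub>0 'k::field_char_0"
  shows "lookup (coproduct A x) (J, K) =
    (if J \<in> sentences A \<and> K \<in> sentences A then lookup x (J @ K) else 0)"
proof -
  have "lookup (\<Sum>(J, K) \<in> {(J, K) \<in> sentences A \<times> sentences A. J @ K = L}. M J \<otimes> M K) (J, K) =
      (if J @ K = L \<and> J \<in> sentences A \<and> K \<in> sentences A then 1 else (0 :: 'k))"
    (is "lookup (sum _ ?P) _ = _") for L
  proof -
    have fin: "finite ?P"
      by (rule finite_subset[OF _ finite_decompositions[of A L]]) auto
    have "lookup (\<Sum>(J, K) \<in> ?P. M J \<otimes> M K) (J, K) =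
        (\<Sum>p \<in> ?P. if p = (J, K) then 1 else (0 :: 'k))"
      unfolding lookup_sum
      by (intro sum.cong) (simp_all add: lookup_tensor lookup_M split: prod.splits)
    also have "\<dots> = (if J @ K = L \<and> J \<in> sentences A \<and> K \<in> sentences A then 1 else 0)"
      using fin by (auto simp: sum.delta)
    finally show ?thesis .
  qed
  then have "lookup (coproduct A x) (J, K) = (\<Sum>L\<in>keys x.
      if L = J @ K then if J \<in> sentences A \<and> K \<in> sentences A then lookup x L else 0 else 0)"
    unfolding coproduct_def lin_ext_def lookup_sum lookup_scale
    by (intro sum.cong) auto
  then show ?thesis
    by (simp add: sum.delta in_keys_iff)
qed

theorem proposition5p1:
  fixes A :: "'a set" and I :: "'a sentence"
  assumes "finite A" and "I \<in> sentences A"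
  shows "coproduct A (F A I :: 'a sentence \<Rightarrow>\<^sub>0 'k::field_char_0) =
    (\<Sum>(K', K'') \<in> {(K', K'') \<in> sentences A \<times> sentences A.
        K' @ K'' = I \<or> (K' \<noteq> [] \<and> K'' \<noteq> [] \<and> near_concat K' K'' = I)}.
      F A K' \<otimes> F A K'')"
    (is "_ = sum _ ?D")
proof (rule poly_mapping_eqI)
  fix p :: "'a sentence \<times> 'a sentence"
  obtain J K where p: "p = (J, K)" by (cases p)
  let ?S = "sentences A"
  let ?P = "\<lambda>(K', K''). J \<preceq>\<^sub>r K' \<and> K \<preceq>\<^sub>r K''"
  let ?R = "{q \<in> ?D. ?P q}"
  have D: "?D = {(K', K'') \<in> ?S \<times> ?S. decomposes I K' K''}"
    by (simp add: decomposes_def)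
  have fin: "finite ?D" by (rule finite_decompositions)
  have "lookup (\<Sum>(K', K'') \<in> ?D. F A K' \<otimes> F A K'') p =
      (\<Sum>q \<in> ?D. if ?P q then if J \<in> ?S \<and> K \<in> ?S then 1 else (0 :: 'k) else 0)"
    unfolding lookup_sum p
    by (intro sum.cong) (simp_all add: lookup_tensor lookup_F split: prod.splits)
  also have "\<dots> = (\<Sum>q \<in> ?R. if J \<in> ?S \<and> K \<in> ?S then 1 else 0)"
    by (rule sum.inter_filter[OF fin, symmetric])
  \<comment> \<open>The summand is constant on \<open>?R\<close>, so it remains to see that
    \<open>?R\<close> is a singleton or, for \<open>J\<close> and \<open>K\<close> in
    \<open>?S\<close>, empty.\<close>
  also have "\<dots> = (if J \<in> ?S \<and> K \<in> ?S then of_nat (card ?R) else 0)"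
    by simp
  also have "\<dots> = (if J \<in> ?S \<and> K \<in> ?S \<and> J @ K \<preceq>\<^sub>r I then 1 else 0)"
  proof (cases "J \<in> ?S \<and> K \<in> ?S \<and> J @ K \<preceq>\<^sub>r I")
    case True
    then have JK: "J \<in> ?S" "K \<in> ?S" "J @ K \<preceq>\<^sub>r I" by simp_all
    obtain K' K'' where K: "decomposes I K' K''" "J \<preceq>\<^sub>r K'" "K \<preceq>\<^sub>r K''"
      by (rule decomposes_refines_append[OF JK(3)])
    have KS: "K' \<in> ?S" "K'' \<in> ?S"
      using refines_in_sentences[OF K(2) JK(1)] refines_in_sentences[OF K(3) JK(2)] .
    have "?R = {(K', K'')}"
    proof (intro equalityI subrelI)
      fix L' L'' assume "(L', L'') \<in> ?R"
      then have L: "L' \<in> ?S" "L'' \<in> ?S" "decomposes I L' L''" "J \<preceq>\<^sub>r L'"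
        unfolding D by auto
      have "concat L' = concat K'"
        using concat_refines[OF L(4)] concat_refines[OF K(2)] by simp
      with L(1-3) K(1) KS have "L' = K' \<and> L'' = K''"
        by (intro decomposes_unique[of I]) (simp_all add: sentences_iff)
      then show "(L', L'') \<in> {(K', K'')}" by simp
    qed (use K KS in \<open>simp add: decomposes_def\<close>)
    with True show ?thesis by simp
  next
    case False
    show ?thesis
    \<comment> \<open>If \<open>J\<close> or \<open>K\<close> is not a sentence over
      \<open>A\<close>, both sides are 0 whatever \<open>?R\<close> is.\<close>
    proof (cases "J \<in> ?S \<and> K \<in> ?S")
      case True
      with False have "\<not> J @ K \<preceq>\<^sub>r I" by simp
      then have "?R = {}"
        unfolding D using refines_append_decomposes[of I _ _ J K] by fast
      then have "card ?R = 0" by (simp only: card.empty)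
      with False show ?thesis by (simp only: of_nat_0 if_False if_cancel)
    qed (simp only: if_False simp_thms conj_assoc[symmetric])
  qed
  also have "\<dots> = lookup (coproduct A (F A I)) p"
    by (simp add: p lookup_coproduct lookup_F append_in_sentences)
  finally show "lookup (coproduct A (F A I)) p =
      lookup (\<Sum>(K', K'') \<in> ?D. F A K' \<otimes> F A K'' :: _ \<Rightarrow>\<^sub>0 'k) p"
    by (rule sym)
qed

end
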